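(* Let $\mathcal{G}=(V,E)$ be a connected, undirected and unweighted finite graph, and let $\mathbf{H}=(H(i,j))_{i,j\in V}$ be an invertible (real) graph filter on $\mathcal{G}$ with geodesic-width $\omega(\mathbf{H})$. Let $\mathbf{P}_{\mathbf{H}}$ be the diagonal matrix with diagonal entries $$P_{\mathbf{H}}(i,i)=\max_{k\in B(i,\omega(\mathbf{H}))}\Big\{\max\Big(\sum_{j\in B(k,\omega(\mathbf{H}))}|H(j,k)|,\ \sum_{j\in B(k,\omega(\mathbf{H}))}|H(k,j)|\Big)\Big\},\quad i\in V.$$ Let $\mathbf{y}\in\mathbb{R}^V$, let $\mathbf{x}^{(0)}\in\mathbb{R}^V$ be an arbitrary initial vector, and define $\mathbf{x}^{(m)}$, $m\ge 1$, iteratively by $$\mathbf{e}^{(m)}=\mathbf{H}\mathbf{x}^{(m-1)}-\mathbf{y},\qquad \mathbf{x}^{(m)}=\mathbf{x}^{(m-1)}-\mathbf{P}_{\mathbf{H}}^{-2}\mathbf{H}^T\mathbf{e}^{(m)},\quad m\ge 1.$$ Then for all $m\ge 0$, $$\|\mathbf{P}_{\mathbf{H}}(\mathbf{x}^{(m)}-\mathbf{H}^{-1}\mathbf{y})\|_2\le \big(r(\mathbf{I}-\mathbf{P}_{\mathbf{H}}^{-1}\mathbf{H}^T\mathbf{H}\mathbf{P}_{\mathbf{H}}^{-1})\big)^m\,\|\mathbf{P}_{\mathbf{H}}(\mathbf{x}^{(0)}-\mathbf{H}^{-1}\mathbf{y})\|_2.$$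
   Context: For a connected, undirected and unweighted finite graph $\mathcal{G}=(V,E)$, the geodesic distance $\rho(i,j)$ between $i,j\in V$ is the number of edges in a shortest path connecting $i$ and $j$, and $B(i,s)=\{j\in V:\ \rho(j,i)\le s\}$, $s\ge 0$, is the set of all $s$-hop neighbors of $i$ (including $i$ itself). A graph filter is a real matrix $\mathbf{H}=(H(i,j))_{i,j\in V}$ indexed by the vertices. It has geodesic-width $\omega(\mathbf{H})$ (a nonnegative integer) if $H(i,j)=0$ for all $i,j\in V$ with $\rho(i,j)>\omega(\mathbf{H})$. $r(\mathbf{A})$ denotes the spectral radius of a matrix $\mathbf{A}$, $\mathbf{I}$ the identity matrix, and $\|\mathbf{x}\|_2=(\sum_{j\in V}|x(j)|^2)^{1/2}$ for $\mathbf{x}=(x(j))_{j\in V}$. *)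

theory Defs
  imports "HOL-Analysis.Analysis" "Graph_Theory.Graph_Theory"
begin

text \<open>An undirected graph is encoded as a symmetric digraph, so an undirected path from \<open>i\<close> to
  \<open>j\<close> is a directed one with the same number of edges. The value is junk when \<open>j\<close> is
  not reachable from \<open>i\<close>, which cannot happen in a connected graph.\<close>

definition geodesic_dist :: "('v, 'e) pre_digraph \<Rightarrow> 'v \<Rightarrow> 'v \<Rightarrow> nat" where
  "geodesic_dist G i j = (LEAST n. \<exists>p. pre_digraph.apath G i p j \<and> length p = n)"

definition geodesic_ball :: "('v, 'e) pre_digraph \<Rightarrow> 'v \<Rightarrow> nat \<Rightarrow> 'v set" where
  "geodesic_ball G i s = {j \<in> verts G. geodesic_dist G j i \<le> s}"

text \<open>A filter does not determine its geodesic-width: the vanishing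
  condition is monotone in the width, and no minimality is required.\<close>

definition has_geodesic_width ::
    "('v, 'e) pre_digraph \<Rightarrow> real ^ 'v ^ 'v \<Rightarrow> nat \<Rightarrow> bool" where
  "has_geodesic_width G H w \<longleftrightarrow>
     (\<forall>i\<in>verts G. \<forall>j\<in>verts G. geodesic_dist G i j > w \<longrightarrow> H $ i $ j = 0)"

definition precond :: "('v::finite, 'e) pre_digraph \<Rightarrow> real ^ 'v ^ 'v \<Rightarrow> nat \<Rightarrow> real ^ 'v ^ 'v" where
  "precond G H w = (\<chi> i j. if i = j
     then Max ((\<lambda>k. max (\<Sum>j\<in>geodesic_ball G k w. \<bar>H $ j $ k\<bar>)
                        (\<Sum>j\<in>geodesic_ball G k w. \<bar>H $ k $ j\<bar>)) ` geodesic_ball G i w)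
     else 0)"

text \<open>Eigenvalues of a real matrix are taken over the complex numbers. There are finitely
  many and at least one, so the supremum below is a maximum.\<close>

definition complex_eigenvalues :: "real ^ 'n ^ 'n \<Rightarrow> complex set" where
  "complex_eigenvalues A =
     {c. \<exists>v :: complex ^ 'n. v \<noteq> 0 \<and> (\<chi> i j. complex_of_real (A $ i $ j)) *v v = c *s v}"

definition spectral_rad :: "real ^ 'n ^ 'n \<Rightarrow> real" where
  "spectral_rad A = (SUP c\<in>complex_eigenvalues A. cmod c)"

end

theory Submission
  imports Defs
begin

text \<open>With \<open>z m = P (x m - H\<inverse> y)\<close> the iteration reads \<open>z (m + 1) = A z m\<close> for the symmetric
  matrix \<open>A = I - P\<inverse> H\<^sup>T H P\<inverse>\<close>, and a symmetric matrix contracts the Euclidean norm by its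
  spectral radius. For the latter, a unit vector \<open>v\<close> that maximizes \<open>norm (A v) = \<mu>\<close> satisfies
  \<open>A\<^sup>2 v = \<mu>\<^sup>2 v\<close> (equality in Cauchy-Schwarz), so \<open>\<mu>\<close> or \<open>-\<mu>\<close> is an eigenvalue of \<open>A\<close>.\<close>

lemma norm_vector_smult_complex:
  fixes v :: "complex ^ 'n"
  shows "norm (c *s v) = cmod c * norm v"
  by (simp add: norm_vec_def norm_mult L2_set_right_distrib)

text \<open>An operator norm bound for the complexified matrix \<open>M\<close> bounds every
  eigenvalue; real linearity suffices for such a bound in finite dimension. Boundedness makes the
  supremum in \<open>spectral_rad\<close> a genuine upper bound.\<close>

lemma bdd_above_cmod_complex_eigenvalues:
  fixes A :: "real ^ 'n ^ 'n"
  shows "bdd_above (cmod ` complex_eigenvalues A)"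
proof -
  define M :: "complex ^ 'n ^ 'n" where "M = (\<chi> i j. complex_of_real (A $ i $ j))"
  have "linear ((*v) M)"
    by (rule linearI)
      (simp_all add: matrix_vector_mult_def vec_eq_iff scaleR_sum_right distrib_left sum.distrib)
  then obtain K where K: "\<And>v. norm (M *v v) \<le> norm v * K"
    using linear_conv_bounded_linear bounded_linear.bounded by blast
  have "cmod c \<le> K" if "c \<in> complex_eigenvalues A" for c
  proof -
    from that obtain v where v: "v \<noteq> 0" "M *v v = c *s v"
      by (auto simp: complex_eigenvalues_def M_def)
    have "cmod c * norm v \<le> norm v * K"
      using K[of v] v(2) by (simp add: norm_vector_smult_complex)
    with v(1) show ?thesis by (simp add: mult.commute)
  qed
  then show ?thesis by (rule bdd_aboveI2)
qed

text \<open>A real eigenvector, read as a complex vector, is an eigenvector of the complexified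
  matrix for the same eigenvalue.\<close>

lemma real_eigenvalue_le_spectral_rad:
  fixes A :: "real ^ 'n ^ 'n"
  assumes "v \<noteq> 0" and Av: "A *v v = c *\<^sub>R v"
  shows "\<bar>c\<bar> \<le> spectral_rad A"
proof -
  define u :: "complex ^ 'n" where "u = (\<chi> i. complex_of_real (v $ i))"
  have "u \<noteq> 0" using assms(1) by (auto simp: u_def vec_eq_iff)
  moreover have "(\<chi> i j. complex_of_real (A $ i $ j)) *v u = complex_of_real c *s u"
  proof -
    have "(\<Sum>j\<in>UNIV. A $ i $ j * v $ j) = c * v $ i" for i
      using arg_cong[OF Av, of "\<lambda>z. z $ i"] by (simp add: matrix_vector_mult_def)
    then have "(\<Sum>j\<in>UNIV. complex_of_real (A $ i $ j) * complex_of_real (v $ j))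
        = complex_of_real c * complex_of_real (v $ i)" for i
      by (metis (no_types, lifting) of_real_mult of_real_sum sum.cong)
    then show ?thesis
      by (simp add: vec_eq_iff matrix_vector_mult_def u_def)
  qed
  ultimately have "complex_of_real c \<in> complex_eigenvalues A"
    unfolding complex_eigenvalues_def by blast
  then show ?thesis
    unfolding spectral_rad_def
    using cSUP_upper[OF _ bdd_above_cmod_complex_eigenvalues, of "complex_of_real c" A] by simp
qed

lemma norm_symmetric_matrix_mult_le:
  fixes A :: "real ^ 'n ^ 'n" and z :: "real ^ 'n"
  assumes sym: "transpose A = A"
  shows "norm (A *v z) \<le> spectral_rad A * norm z"
proof -
  have adj: "(A *v a) \<bullet> b = a \<bullet> (A *v b)" for a b
    by (metis dot_lmul_matrix sym vector_transpose_matrix)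
  have "continuous_on (sphere 0 1) (\<lambda>v. norm (A *v v))"
    by (intro continuous_intros matrix_vector_mult_linear_continuous_on)
  moreover have "sphere (0 :: real ^ 'n) 1 \<noteq> {}" by simp
  ultimately obtain v where v: "norm v = 1"
    and max: "\<And>u. norm u = 1 \<Longrightarrow> norm (A *v u) \<le> norm (A *v v)"
    using continuous_attains_sup[OF compact_sphere, of 0 1 "\<lambda>v. norm (A *v v)"]
    by (auto simp: dist_norm)
  define \<mu> where "\<mu> = norm (A *v v)"
  have bound: "norm (A *v u) \<le> \<mu> * norm u" for u
  proof (cases "u = 0")
    case False
    have "norm (A *v ((1 / norm u) *\<^sub>R u)) \<le> \<mu>"
      unfolding \<mu>_def using False by (intro max) simp
    then show ?thesis
      using False by (simp add: matrix_vector_mult_scaleR field_simps)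
  qed simp
  let ?w = "A *v (A *v v)"
  \<comment> \<open>Symmetry moves one factor \<open>A\<close> to the other side of the inner
    product.\<close>
  have wv: "?w \<bullet> v = \<mu>\<^sup>2"
    by (simp add: adj \<mu>_def power2_norm_eq_inner)
  have "norm ?w \<le> \<mu>\<^sup>2"
    using bound[of "A *v v"] by (simp add: \<mu>_def power2_eq_square)
  then have "(norm ?w)\<^sup>2 \<le> (\<mu>\<^sup>2)\<^sup>2" by (intro power_mono) auto
  \<comment> \<open>This is the equality case of Cauchy-Schwarz made explicit: the left side is
    nonnegative, and the bound on \<open>norm ?w\<close> makes the right side nonpositive, so both
    vanish.\<close>
  moreover have "(norm (?w - \<mu>\<^sup>2 *\<^sub>R v))\<^sup>2 = (norm ?w)\<^sup>2 - (\<mu>\<^sup>2)\<^sup>2"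
  proof -
    have "(norm (a - c *\<^sub>R v))\<^sup>2 = (norm a)\<^sup>2 - 2 * c * (a \<bullet> v) + c\<^sup>2 * (norm v)\<^sup>2" for a c
      unfolding power2_norm_eq_inner
      by (simp add: inner_diff_left inner_diff_right inner_commute power2_eq_square algebra_simps)
    from this[of ?w "\<mu>\<^sup>2"] wv v show ?thesis by (simp add: power2_eq_square)
  qed
  ultimately have w: "?w = \<mu>\<^sup>2 *\<^sub>R v"
    using zero_le_power2[of "norm (?w - \<mu>\<^sup>2 *\<^sub>R v)"] by auto
  have "v \<noteq> 0" using v by auto
  \<comment> \<open>Since (A - \<mu>)(A + \<mu>) v = 0, the vector \<open>u\<close> lies in the
    kernel of A - \<mu>. If \<open>u\<close> is zero, then \<open>v\<close> itself is an eigenvector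
    for -\<mu>.\<close>
  define u where "u = A *v v + \<mu> *\<^sub>R v"
  have Au: "A *v u = \<mu> *\<^sub>R u"
    by (simp add: u_def w matrix_vector_right_distrib matrix_vector_mult_scaleR
        power2_eq_square scaleR_add_right)
  have "\<bar>\<mu>\<bar> \<le> spectral_rad A"
  proof (cases "u = 0")
    case True
    then have "A *v v = (- \<mu>) *\<^sub>R v" by (simp add: u_def eq_neg_iff_add_eq_0)
    from real_eigenvalue_le_spectral_rad[OF \<open>v \<noteq> 0\<close> this] show ?thesis by simp
  next
    case False
    then show ?thesis using Au by (rule real_eigenvalue_le_spectral_rad)
  qed
  then have "\<mu> * norm z \<le> spectral_rad A * norm z"
    by (intro mult_right_mono) auto
  with bound[of z] show ?thesis by linarith
qed

text \<open>Apply the norm bound to any unit vector. The sign is what allows the bound to be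
  multiplied through when it is iterated.\<close>

lemma spectral_rad_nonneg_if_symmetric:
  fixes A :: "real ^ 'n ^ 'n"
  assumes "transpose A = A"
  shows "0 \<le> spectral_rad A"
proof -
  obtain v :: "real ^ 'n" where "norm v = 1" using vector_choose_size[of 1] by auto
  with norm_symmetric_matrix_mult_le[OF assms, of v] show ?thesis
    by (metis mult.right_neutral norm_ge_zero order_trans)
qed

lemma norm_symmetric_matrix_iterate_le:
  fixes A :: "real ^ 'n ^ 'n" and z :: "nat \<Rightarrow> real ^ 'n"
  assumes sym: "transpose A = A" and step: "\<And>m. z (Suc m) = A *v z m"
  shows "norm (z m) \<le> spectral_rad A ^ m * norm (z 0)"
proof (induction m)
  case (Suc m)
  have "norm (z (Suc m)) \<le> spectral_rad A * norm (z m)"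
    using norm_symmetric_matrix_mult_le[OF sym] by (simp add: step)
  also have "\<dots> \<le> spectral_rad A * (spectral_rad A ^ m * norm (z 0))"
    using Suc.IH spectral_rad_nonneg_if_symmetric[OF sym] by (rule mult_left_mono)
  finally show ?case by (simp add: mult.assoc)
qed simp

lemma
  fixes A :: "real ^ 'n ^ 'n"
  assumes "invertible A"
  shows matrix_inv_right: "A ** matrix_inv A = mat 1"
    and matrix_inv_left: "matrix_inv A ** A = mat 1"
  using someI_ex[OF assms[unfolded invertible_def]] by (simp_all add: matrix_inv_def)

text \<open>One side is a left inverse and the other a right inverse of \<open>transpose P\<close>,
  so they coincide.\<close>

lemma transpose_matrix_inv:
  fixes P :: "real ^ 'n ^ 'n"
  assumes "invertible P"
  shows "transpose (matrix_inv P) = matrix_inv (transpose P)"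
proof -
  have "transpose (matrix_inv P) ** transpose P = mat 1"
    by (simp add: matrix_inv_right[OF assms] flip: matrix_transpose_mul)
  moreover have "transpose P ** matrix_inv (transpose P) = mat 1"
    using assms by (intro matrix_inv_right transpose_invertible)
  ultimately show ?thesis
    using matrix_mul_assoc[of "transpose (matrix_inv P)" "transpose P" "matrix_inv (transpose P)"]
    by simp
qed

text \<open>The empty path has length 0. Hence \<open>k = i\<close> is among the indices of the
  maximum that defines the diagonal entry of \<open>precond\<close> at \<open>i\<close>.\<close>

lemma self_in_geodesic_ball:
  assumes "i \<in> verts G"
  shows "i \<in> geodesic_ball G i s"
proof -
  have "pre_digraph.apath G i [] i"
    using assms by (simp add: pre_digraph.apath_def pre_digraph.awalk_def
        pre_digraph.awalk_verts.simps pre_digraph.cas.simps)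
  then have "geodesic_dist G i i = 0"
    unfolding geodesic_dist_def by (intro Least_eq_0) auto
  with assms show ?thesis by (simp add: geodesic_ball_def)
qed

lemma transpose_precond: "transpose (precond G H w) = precond G H w"
  by (simp add: precond_def transpose_def vec_eq_iff)

text \<open>An invertible \<open>H\<close> has a nonzero entry in column \<open>i\<close>. The width
  condition places its row index in the ball around \<open>i\<close>, so the column sum for
  \<open>k = i\<close> is positive, and the maximum dominates it.\<close>

lemma precond_diagonal_pos:
  fixes H :: "real ^ 'v ^ 'v"
  assumes V: "verts G = UNIV" and H: "invertible H" and width: "has_geodesic_width G H w"
  shows "0 < precond G H w $ i $ i"
proof -
  let ?B = "geodesic_ball G i w"
  let ?f = "\<lambda>k. max (\<Sum>j\<in>geodesic_ball G k w. \<bar>H $ j $ k\<bar>) (\<Sum>j\<in>geodesic_ball G k w. \<bar>H $ k $ j\<bar>)"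
  have "column i H \<noteq> 0"
  proof
    assume "column i H = 0"
    then have "H *v axis i 1 = 0" by (simp add: matrix_vector_mul_component flip: matrix_vector_mult_basis)
    moreover have "axis i (1 :: real) \<noteq> 0" by (simp add: axis_eq_0_iff)
    ultimately show False
      using H by (metis matrix_left_invertible_ker invertible_def)
  qed
  then obtain j where j: "H $ j $ i \<noteq> 0" by (auto simp: column_def vec_eq_iff)
  \<comment> \<open>A distance \<open>geodesic_dist G j i\<close> above \<open>w\<close> would force
    the entry \<open>H $ j $ i\<close> to vanish.\<close>
  with width V have "j \<in> ?B"
    by (force simp: has_geodesic_width_def geodesic_ball_def not_less)
  then have "\<bar>H $ j $ i\<bar> \<le> (\<Sum>j\<in>?B. \<bar>H $ j $ i\<bar>)"
    by (intro member_le_sum) auto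
  also have "\<dots> \<le> ?f i" by simp
  also have "\<dots> \<le> Max (?f ` ?B)"
    using V by (intro Max_ge) (auto intro!: imageI self_in_geodesic_ball)
  finally show ?thesis using j by (simp add: precond_def)
qed

lemma invertible_precond:
  fixes H :: "real ^ 'v ^ 'v"
  assumes "verts G = UNIV" "invertible H" "has_geodesic_width G H w"
  shows "invertible (precond G H w)"
proof -
  have "det (precond G H w) = (\<Prod>i\<in>UNIV. precond G H w $ i $ i)"
    by (rule det_diagonal) (simp add: precond_def)
  then show ?thesis
    using precond_diagonal_pos[OF assms] by (simp add: invertible_det_nz less_imp_neq[symmetric])
qed

theorem mainTheorem2:
  fixes G :: "('v::finite, 'e) pre_digraph"
    and H P :: "real ^ 'v ^ 'v"
    and w :: nat
    and y :: "real ^ 'v"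
    and x e :: "nat \<Rightarrow> real ^ 'v"
  assumes "pseudo_graph G"
    and "Digraph_Component.connected G"
    and "verts G = UNIV"
    and "invertible H"
    and "has_geodesic_width G H w"
    and "P = precond G H w"
    and "\<And>m. m \<ge> 1 \<Longrightarrow> e m = H *v x (m - 1) - y"
    and "\<And>m. m \<ge> 1 \<Longrightarrow>
           x m = x (m - 1) - (matrix_inv P ** matrix_inv P ** transpose H) *v e m"
  shows "\<forall>m. norm (P *v (x m - matrix_inv H *v y))
           \<le> spectral_rad (mat 1 - matrix_inv P ** transpose H ** H ** matrix_inv P) ^ m
               * norm (P *v (x 0 - matrix_inv H *v y))"
proof -
  let ?Q = "matrix_inv P"
  let ?A = "mat 1 - ?Q ** transpose H ** H ** ?Q"
  let ?z = "\<lambda>m. P *v (x m - matrix_inv H *v y)"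
  have P: "invertible P" using assms(3-6) invertible_precond by blast
  \<comment> \<open>\<open>P\<close> is diagonal, hence symmetric, and so is its inverse.\<close>
  have "transpose ?Q = ?Q"
    using P transpose_matrix_inv[of P] by (simp add: assms(6) transpose_precond)
  moreover have "transpose (B - C) = transpose B - transpose C" for B C :: "real ^ 'v ^ 'v"
    by (simp add: transpose_def vec_eq_iff)
  ultimately have sym: "transpose ?A = ?A"
    by (simp add: matrix_transpose_mul transpose_mat matrix_mul_assoc)
  have cancel: "P ** (?Q ** B) = B" for B :: "real ^ 'v ^ 'v"
    by (simp add: matrix_mul_assoc matrix_inv_right[OF P])
  have step: "?z (Suc m) = ?A *v ?z m" for m
  proof -
    let ?d = "x m - matrix_inv H *v y"
    \<comment> \<open>As H maps \<open>matrix_inv H *v y\<close> to \<open>y\<close>, the residual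
      is the image of the current error \<open>?d\<close>.\<close>
    have "e (Suc m) = H *v ?d"
      using assms(7)[of "Suc m"]
      by (simp add: matrix_vector_mult_diff_distrib matrix_vector_mul_assoc matrix_inv_right[OF assms(4)])
    then have "x (Suc m) - matrix_inv H *v y = ?d - (?Q ** ?Q ** transpose H) *v (H *v ?d)"
      using assms(8)[of "Suc m"] by simp
    then have "?z (Suc m) = ?z m - (P ** ?Q ** ?Q ** transpose H ** H) *v ?d"
      by (simp only: matrix_vector_mult_diff_distrib matrix_vector_mul_assoc matrix_mul_assoc)
    \<comment> \<open>On the left, \<open>P\<close> cancels one of the two factors
      \<open>?Q\<close>; on the right, \<open>?Q ** P\<close> is the identity, inserted so that the
      matrix acts on \<open>P *v ?d\<close>, that is, on \<open>?z m\<close>.\<close>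
    also have "P ** ?Q ** ?Q ** transpose H ** H = ?Q ** transpose H ** H ** ?Q ** P"
      by (simp add: matrix_inv_left[OF P] cancel flip: matrix_mul_assoc)
    finally show ?thesis
      by (simp only: matrix_vector_mult_diff_rdistrib matrix_vector_mul_lid
          flip: matrix_vector_mul_assoc)
  qed
  show ?thesis
    using norm_symmetric_matrix_iterate_le[where z = ?z, OF sym step] by blast
qed

end
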